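(* Let $S_*$ be the set of minimizers of $f+g$ over $\mathcal{H}$, assume $S_*\neq\emptyset$, and let $s_*:=\min_{x\in\mathcal{H}}(f+g)(x)$. Let $(x^k)_{k\in\mathbb{N}}$ be the sequence generated by the PSS Method with stepsizes $$\alpha_k=\gamma_k\frac{(f+g)(x^k)-s_*}{\|u^k\|^2+2\rho_k\|u^k\|+\rho_k^2},\qquad k\in\mathbb{N},$$ where $0<\gamma\le\gamma_k\le 2-\gamma$ and $\rho_k:=\|w^k\|$ with $w^k$ any chosen element of $\partial g(x^k)$. Then: (a) $(x^k)_{k\in\mathbb{N}}$ is Fejér convergent to $S_*$. (b) $\lim_{k\to\infty}(f+g)(x^k)=\min_{x\in\mathcal{H}}(f+g)(x)$. (c) $(x^k)_{k\in\mathbb{N}}$ is weakly convergent to some $\tilde x\in S_*$. (d) $\liminf_{k\to\infty}\sqrt{k+1}\cdot\left[(f+g)(x^k)-\min_{x\in\mathcal{H}}(f+g)(x)\right]=0$.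
   Context: Setting. $\mathcal{H}$ is a nontrivial real Hilbert space; $f,g:\mathcal{H}\to\mathbb{R}\cup\{+\infty\}$ are proper, lower semicontinuous and convex, with $\operatorname{dom}(g)\subseteq\operatorname{dom}(f)$, where $\operatorname{dom}(h)=\{x: h(x)<+\infty\}$. $\partial$ denotes the convex subdifferential, $\mathbb{N}=\{0,1,2,\dots\}$, and $\mathbb{B}[0;r]$ is the closed ball of radius $r$ centered at $0$. Standing assumptions: A1: $\partial f$ is bounded on bounded sets of $\operatorname{dom}(g)$: for every bounded and closed $V\subseteq\operatorname{dom}(g)$ there is $\zeta>0$ with $\partial f(x)\subseteq\mathbb{B}[0;\zeta]$ for all $x\in V$. A2: there is $\rho\ge 0$ such that $\partial g(x)\cap\mathbb{B}[0;\rho]\ne\emptyset$ for all $x\in\operatorname{dom}(g)$. For $\alpha>0$, $\operatorname{prox}_{\alpha g}(z)$ is the unique minimizer over $y\in\mathcal{H}$ of $\alpha g(y)+\frac12\|y-z\|^2$. PSS Method (Proximal Subgradient Splitting Method): take $x^0\in\operatorname{dom}(g)$ and, for $k\in\mathbb{N}$, set $x^{k+1}=\operatorname{prox}_{\alpha_k g}(x^k-\alpha_k u^k)$, where $u^k\in\partial f(x^k)$ and the stepsize $\alpha_k$ is positive. The method stops if $x^{k+1}=x^k$; it is assumed that it never stops, so that $(x^k)_{k\in\mathbb{N}}$ is an infinite sequence. A sequence $(x^k)$ in $\mathcal{H}$ is Fejér convergent to a nonempty set $S\subseteq\mathcal{H}$ if $\|x^{k+1}-x\|\le\|x^k-x\|$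 for all $x\in S$ and $k\in\mathbb{N}$.
   Formalization: Parts (b)–(d) are proved under the added assumption that the chosen subgradients w^k (equivalently the ρ_k) are bounded, as A2 permits; for unbounded w^k, e.g. f(a,b)=|a|+b, g the indicator of {b≥0}, ‖w^k‖=2^{k+1}, they fail. Part (a) holds for arbitrary w^k. *)

theory Defs
  imports "HOL-Analysis.Analysis"
begin

definition effective_domain :: "('a \<Rightarrow> ereal) \<Rightarrow> 'a set" where
  "effective_domain h = {x. h x < \<infinity>}"

definition proper :: "('a \<Rightarrow> ereal) \<Rightarrow> bool" where
  "proper h \<longleftrightarrow> (\<forall>x. h x \<noteq> -\<infinity>) \<and> effective_domain h \<noteq> {}"

definition lower_semicontinuous :: "('a::topological_space \<Rightarrow> ereal) \<Rightarrow> bool" where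
  "lower_semicontinuous h \<longleftrightarrow> (\<forall>x. h x \<le> Liminf (at x) h)"

(* The library's convex_on is restricted to real-valued functions.  For functions avoiding
   -\<infinity> every sum below is unambiguous; t ranges over the open interval so that no product
   0 * \<infinity> occurs. *)
definition convex_fun :: "('a::real_vector \<Rightarrow> ereal) \<Rightarrow> bool" where
  "convex_fun h \<longleftrightarrow> (\<forall>x y. \<forall>t::real. 0 < t \<and> t < 1 \<longrightarrow>
     h ((1 - t) *\<^sub>R x + t *\<^sub>R y) \<le> ereal (1 - t) * h x + ereal t * h y)"

definition subdifferential :: "('a::real_inner \<Rightarrow> ereal) \<Rightarrow> 'a \<Rightarrow> 'a set" where
  "subdifferential h x = {v. \<forall>y. h x + ereal (v \<bullet> (y - x)) \<le> h y}"

definition minimizers :: "('a \<Rightarrow> ereal) \<Rightarrow> 'a set" where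
  "minimizers h = {x. \<forall>y. h x \<le> h y}"

definition prox :: "real \<Rightarrow> ('a::real_inner \<Rightarrow> ereal) \<Rightarrow> 'a \<Rightarrow> 'a" where
  "prox \<alpha> h z =
     (THE p. p \<in> minimizers (\<lambda>y. ereal \<alpha> * h y + ereal ((norm (y - z))\<^sup>2 / 2)))"

(* The last conjunct says that the stopping test never succeeds. *)
definition pss_sequence ::
  "('a::real_inner \<Rightarrow> ereal) \<Rightarrow> ('a \<Rightarrow> ereal) \<Rightarrow> (nat \<Rightarrow> real) \<Rightarrow> (nat \<Rightarrow> 'a) \<Rightarrow> (nat \<Rightarrow> 'a) \<Rightarrow> bool"
  where
  "pss_sequence f g \<alpha> u x \<longleftrightarrow>
     x 0 \<in> effective_domain g \<and>
     (\<forall>k. 0 < \<alpha> k) \<and>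
     (\<forall>k. u k \<in> subdifferential f (x k)) \<and>
     (\<forall>k. x (Suc k) = prox (\<alpha> k) g (x k - \<alpha> k *\<^sub>R u k)) \<and>
     (\<forall>k. x (Suc k) \<noteq> x k)"

definition fejer_convergent :: "(nat \<Rightarrow> 'a::real_normed_vector) \<Rightarrow> 'a set \<Rightarrow> bool" where
  "fejer_convergent x S \<longleftrightarrow>
     S \<noteq> {} \<and> (\<forall>z\<in>S. \<forall>k. norm (x (Suc k) - z) \<le> norm (x k - z))"

definition weakly_convergent_to :: "(nat \<Rightarrow> 'a::real_inner) \<Rightarrow> 'a \<Rightarrow> bool" where
  "weakly_convergent_to x l \<longleftrightarrow> (\<forall>v. (\<lambda>k. x k \<bullet> v) \<longlonglongrightarrow> l \<bullet> v)"

end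

theory Submission
  imports Defs
begin

text \<open>
  The optimality condition of the proximal step and the subgradient inequalities for f and g at
  \<open>x\<^sub>k\<close> give, for every minimizer z,
  \<open>|x\<^sub>k\<^sub>+\<^sub>1 - z|\<^sup>2 \<le> |x\<^sub>k - z|\<^sup>2 - 2\<alpha>\<^sub>k e\<^sub>k + \<alpha>\<^sub>k\<^sup>2 (|u\<^sub>k| + |w\<^sub>k|)\<^sup>2\<close>,
  where \<open>e\<^sub>k\<close> is the gap to the minimal value. The Polyak stepsize turns the last two terms into at most
  \<open>-\<gamma>\<^sup>2 e\<^sub>k\<^sup>2 / (|u\<^sub>k| + |w\<^sub>k|)\<^sup>2\<close>, which is the Fejer property; with bounded subgradients the
  squares \<open>e\<^sub>k\<^sup>2\<close> are summable, so the gaps tend to 0, and their liminf rate follows since the harmonic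
  series diverges.

  Existence of the proximal point and weak convergence both rest on one fact: nested bounded closed
  convex sets in a Hilbert space intersect. For weak convergence it is applied to the closed convex
  hulls of the tails of subsequences. A common point y is a minimizer, and it does not depend on the
  subsequence, because the inner products of \<open>x\<^sub>k\<close> with the difference of two minimizers converge.
\<close>

section \<open>Lower semicontinuity and convexity of extended-real functions\<close>

text \<open>At the point itself \<open>c < h x\<close> holds anyway, so the punctured filter of the
  definition can be replaced by the full one.\<close>

lemma lower_semicontinuous_iff:
  "lower_semicontinuous h \<longleftrightarrow> (\<forall>x. \<forall>c<h x. eventually (\<lambda>y. c < h y) (nhds x))"
  unfolding lower_semicontinuous_def le_Liminf_iff eventually_nhds_conv_at by blast

lemma lower_semicontinuous_closed_sublevel:
  assumes "lower_semicontinuous h"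
  shows "closed {x. h x \<le> c}"
proof -
  have "open {x. c < h x}"
    using assms by (subst open_subopen) (fastforce simp: lower_semicontinuous_iff eventually_nhds)
  moreover have "- {x. h x \<le> c} = {x. c < h x}" by auto
  ultimately show ?thesis by (simp add: closed_def)
qed

text \<open>Transfers a strict lower bound on a sum to its summands, as semicontinuity of sums
  requires. Infinite summands are first replaced by reals below them.\<close>

lemma ereal_less_add_split:
  fixes a b c :: ereal
  assumes "c < a + b" "a \<noteq> -\<infinity>" "b \<noteq> -\<infinity>"
  obtains a' b' where "a' < a" "b' < b" "c \<le> a' + b'" "a' \<noteq> -\<infinity>" "b' \<noteq> -\<infinity>"
proof -
  have real_case: "\<exists>a' b'. a' < a \<and> b' < b \<and> c \<le> a' + b' \<and> a' \<noteq> -\<infinity> \<and> b' \<noteq> -\<infinity>"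
    if rq: "c < ereal r + ereal q" "ereal r \<le> a" "ereal q \<le> b" for r q
  proof -
    obtain e where e: "c < ereal e" "ereal e < ereal (r + q)"
      using ereal_dense2[OF rq(1)] by auto
    \<comment> \<open>Half of the slack between \<open>r + q\<close> and \<open>e\<close>, taken off
      each summand, leaves exactly \<open>e\<close>, which exceeds \<open>c\<close>.\<close>
    define d where "d = (r + q - e) / 2"
    have "d > 0" "(r - d) + (q - d) = e" using e by (auto simp: d_def field_simps)
    then show ?thesis using rq e
      by (intro exI[of _ "ereal (r - d)"] exI[of _ "ereal (q - d)"])
         (auto intro: less_le_trans[of _ "ereal r" a] less_le_trans[of _ "ereal q" b])
  qed
  have c: "c < \<infinity>" using assms(1) by auto
  have fin: "\<exists>r. ereal r \<le> a" if "a \<noteq> -\<infinity>" for a :: ereal using that by (cases a) auto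
  obtain c' where c': "c \<le> ereal c'" using c by (cases c) auto
  have "\<exists>r q. c < ereal r + ereal q \<and> ereal r \<le> a \<and> ereal q \<le> b"
  proof (cases "a = \<infinity>")
    case True
    obtain q where "ereal q \<le> b" using fin assms by blast
    \<comment> \<open>Every real lies below an infinite \<open>a\<close>, so \<open>r\<close> may be
      chosen to make the sum \<open>c' + 1\<close>.\<close>
    then show ?thesis using True c'
      by (intro exI[of _ "c' - q + 1"] exI[of _ q]) (auto intro: le_less_trans[OF c'])
  next
    case False
    then obtain r where r: "a = ereal r" using assms by (cases a) auto
    show ?thesis
    proof (cases "b = \<infinity>")
      case True
      then show ?thesis using r c'
        by (intro exI[of _ r] exI[of _ "c' - r + 1"]) (auto intro: le_less_trans[OF c'])
    next
      case False
      then show ?thesis using r assms by (cases b) auto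
    qed
  qed
  then show ?thesis using real_case that by blast
qed

lemma lower_semicontinuous_add:
  fixes h1 h2 :: "'a::topological_space \<Rightarrow> ereal"
  assumes "lower_semicontinuous h1" "lower_semicontinuous h2"
    and "\<And>x. h1 x \<noteq> -\<infinity>" "\<And>x. h2 x \<noteq> -\<infinity>"
  shows "lower_semicontinuous (\<lambda>x. h1 x + h2 x)"
  unfolding lower_semicontinuous_iff
proof (intro allI impI)
  fix x c assume "c < h1 x + h2 x"
  then obtain a b where ab: "a < h1 x" "b < h2 x" "c \<le> a + b" "a \<noteq> -\<infinity>" "b \<noteq> -\<infinity>"
    using ereal_less_add_split assms(3,4) by metis
  have "\<forall>\<^sub>F y in nhds x. a < h1 y \<and> b < h2 y"
    using assms(1,2) ab(1,2) by (auto simp: lower_semicontinuous_iff intro: eventually_conj)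
  then show "\<forall>\<^sub>F y in nhds x. c < h1 y + h2 y"
    by eventually_elim (use ab in \<open>auto intro: le_less_trans[OF _ ereal_add_strict_mono2]\<close>)
qed

lemma lower_semicontinuous_cmult:
  assumes "lower_semicontinuous h" "0 < a"
  shows "lower_semicontinuous (\<lambda>x. ereal a * h x)"
  unfolding lower_semicontinuous_iff
proof (intro allI impI)
  fix x c assume "c < ereal a * h x"
  then have "c / ereal a < h x"
    using assms(2) by (simp add: ereal_divide_less_pos)
  then have "\<forall>\<^sub>F y in nhds x. c / ereal a < h y"
    using assms(1) by (simp add: lower_semicontinuous_iff)
  then show "\<forall>\<^sub>F y in nhds x. c < ereal a * h y"
    by eventually_elim (use assms ereal_divide_less_pos[of "ereal a"] in auto)
qed

lemma lower_semicontinuous_real: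
  assumes "continuous_on UNIV h"
  shows "lower_semicontinuous (\<lambda>x. ereal (h x))"
  unfolding lower_semicontinuous_iff
proof (intro allI impI)
  fix x c assume "c < ereal (h x)"
  moreover have "((\<lambda>x. ereal (h x)) \<longlongrightarrow> ereal (h x)) (nhds x)"
    using assms
    by (simp add: continuous_on_def flip: tendsto_at_iff_tendsto_nhds)
  ultimately show "\<forall>\<^sub>F y in nhds x. c < ereal (h y)" by (rule order_tendstoD(1)[rotated])
qed

lemma convex_fun_sublevel:
  assumes "convex_fun h"
  shows "convex {x. h x \<le> c}"
  unfolding convex_alt
proof (intro ballI allI impI)
  fix x y and t :: real
  assume xy: "x \<in> {x. h x \<le> c}" "y \<in> {x. h x \<le> c}" and t: "0 \<le> t \<and> t \<le> 1"
  \<comment> \<open>\<open>convex_fun\<close> constrains only interior points of a segment, so the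
    end points are separate cases.\<close>
  consider "t = 0" | "t = 1" | "0 < t" "t < 1" using t by linarith
  then show "(1 - t) *\<^sub>R x + t *\<^sub>R y \<in> {x. h x \<le> c}"
  proof cases
    case 3
    then have "h ((1 - t) *\<^sub>R x + t *\<^sub>R y) \<le> ereal (1 - t) * h x + ereal t * h y"
      using assms by (auto simp: convex_fun_def)
    also have "\<dots> \<le> ereal (1 - t) * c + ereal t * c"
      using xy 3 by (intro add_mono ereal_mult_left_mono) auto
    also have "\<dots> = c" using 3 by (cases c) (auto simp: algebra_simps)
    finally show ?thesis by simp
  qed (use xy in auto)
qed

lemma convex_fun_add:
  assumes "convex_fun h1" "convex_fun h2"
  shows "convex_fun (\<lambda>x. h1 x + h2 x)"
  unfolding convex_fun_def
proof (intro allI impI)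
  fix x y and t :: real assume t: "0 < t \<and> t < 1"
  have "h1 ((1 - t) *\<^sub>R x + t *\<^sub>R y) + h2 ((1 - t) *\<^sub>R x + t *\<^sub>R y) \<le>
    (ereal (1 - t) * h1 x + ereal t * h1 y) + (ereal (1 - t) * h2 x + ereal t * h2 y)"
    using assms t by (intro add_mono) (auto simp: convex_fun_def)
  also have "\<dots> = ereal (1 - t) * (h1 x + h2 x) + ereal t * (h1 y + h2 y)"
    using t by (simp add: ereal_pos_distrib add_ac)
  finally show "h1 ((1 - t) *\<^sub>R x + t *\<^sub>R y) + h2 ((1 - t) *\<^sub>R x + t *\<^sub>R y)
    \<le> ereal (1 - t) * (h1 x + h2 x) + ereal t * (h1 y + h2 y)" .
qed

lemma convex_fun_cmult:
  assumes "convex_fun h" "0 < a"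
  shows "convex_fun (\<lambda>x. ereal a * h x)"
  unfolding convex_fun_def
proof (intro allI impI)
  fix x y and t :: real assume t: "0 < t \<and> t < 1"
  have "ereal a * h ((1 - t) *\<^sub>R x + t *\<^sub>R y) \<le> ereal a * (ereal (1 - t) * h x + ereal t * h y)"
    using assms t by (intro ereal_mult_left_mono) (auto simp: convex_fun_def)
  also have "\<dots> = ereal (1 - t) * (ereal a * h x) + ereal t * (ereal a * h y)"
    using assms by (simp add: ereal_pos_distrib mult.left_commute)
  finally show "ereal a * h ((1 - t) *\<^sub>R x + t *\<^sub>R y) 
    \<le> ereal (1 - t) * (ereal a * h x) + ereal t * (ereal a * h y)" .
qed

text \<open>The subtracted term is the convexity defect of the squared norm, nonnegative for
  \<open>t\<close> in the unit interval.\<close>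

lemma norm_sq_convex_combination:
  fixes p y z :: "'a::real_inner"
  shows "(norm ((1 - t) *\<^sub>R p + t *\<^sub>R y - z))\<^sup>2 =
    (1 - t) * (norm (p - z))\<^sup>2 + t * (norm (y - z))\<^sup>2 - t * (1 - t) * (norm (y - p))\<^sup>2"
  by (simp add: power2_norm_eq_inner algebra_simps inner_commute)

lemma convex_fun_norm_sq:
  "convex_fun (\<lambda>y. ereal ((norm (y - z))\<^sup>2 / 2))" for z :: "'a::real_inner"
  by (auto simp: convex_fun_def norm_sq_convex_combination add_divide_distrib diff_divide_distrib)

section \<open>Nested convex sets, minimizers and cluster points\<close>

text \<open>Nearly shortest vectors of the sets form a Cauchy sequence: the distances
  \<open>d n\<close> from 0 increase to a finite limit, and the parallelogram law turns this into
  closeness of the vectors.\<close>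

lemma nested_bounded_closed_convex_Inter_nonempty:
  fixes C :: "nat \<Rightarrow> 'a::{real_inner, complete_space} set"
  assumes dec: "decseq C" and cl: "\<And>n. closed (C n)" and cv: "\<And>n. convex (C n)"
    and ne: "\<And>n. C n \<noteq> {}" and bd: "bounded (C 0)"
  shows "(\<Inter>n. C n) \<noteq> {}"
proof -
  define d where "d n = infdist 0 (C n)" for n
  have sub: "C m \<subseteq> C n" if "n \<le> m" for m n using dec that by (auto simp: decseq_def)
  have d_le: "d n \<le> norm y" if "y \<in> C n" for n y
    using infdist_le[OF that, of 0] by (simp add: d_def)
  obtain B where B: "\<And>y. y \<in> C 0 \<Longrightarrow> norm y \<le> B" using bd by (auto simp: bounded_iff)
  have "incseq d" unfolding d_def incseq_def using infdist_mono[OF sub ne] by blast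
  moreover have "d n \<le> B" for n
    using ne[of n] d_le[of _ n] B sub[of 0 n] by (meson all_not_in_conv le0 order_trans subsetD)
  ultimately obtain L where L: "d \<longlonglongrightarrow> L" using incseq_convergent by blast
  have "\<exists>y\<in>C n. norm y < d n + 1 / Suc n" for n
  proof -
    have "(INF y\<in>C n. dist 0 y) < d n + 1 / Suc n"
      using ne[of n] by (simp add: d_def infdist_notempty)
    from cInf_lessD[OF _ this] show ?thesis using ne by auto
  qed
  then obtain p where p: "\<And>n. p n \<in> C n" "\<And>n. norm (p n) < d n + 1 / Suc n" by metis
  have "(\<lambda>n. norm (p n)) \<longlonglongrightarrow> L"
  proof (rule tendsto_sandwich[OF _ _ L])
    show "(\<lambda>n. d n + 1 / Suc n) \<longlonglongrightarrow> L"
      using tendsto_add[OF L LIMSEQ_Suc[OF lim_1_over_n]] by simp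
  qed (use d_le p(1) less_imp_le[OF p(2)] in auto)
  then have pL: "(\<lambda>n. (norm (p n))\<^sup>2) \<longlonglongrightarrow> L\<^sup>2" by (intro tendsto_intros)
  have dL: "(\<lambda>n. (d n)\<^sup>2) \<longlonglongrightarrow> L\<^sup>2" using L by (intro tendsto_intros)
  have parallelogram: "(norm (p n - p m))\<^sup>2 \<le> 2 * (norm (p n))\<^sup>2 + 2 * (norm (p m))\<^sup>2 - 4 * (d n)\<^sup>2"
    if "n \<le> m" for m n
  proof -
    \<comment> \<open>The midpoint lies in the larger set \<open>C n\<close>, so its norm is at
      least \<open>d n\<close>.\<close>
    have "(1/2) *\<^sub>R p n + (1/2) *\<^sub>R p m \<in> C n"
      using cv[of n] p(1) sub[OF that] by (intro convexD) auto
    then have "d n \<le> norm ((1/2) *\<^sub>R p n + (1/2) *\<^sub>R p m)" by (rule d_le)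
    then have "(d n)\<^sup>2 \<le> (norm ((1/2) *\<^sub>R p n + (1/2) *\<^sub>R p m))\<^sup>2"
      by (intro power_mono) (auto simp: d_def infdist_nonneg)
    moreover have "(norm (p n - p m))\<^sup>2 + 4 * (norm ((1/2) *\<^sub>R p n + (1/2) *\<^sub>R p m))\<^sup>2
        = 2 * (norm (p n))\<^sup>2 + 2 * (norm (p m))\<^sup>2"
      by (simp add: power2_norm_eq_inner algebra_simps inner_commute)
    ultimately show ?thesis by linarith
  qed
  have "Cauchy p"
    unfolding Cauchy_altdef
  proof (intro allI impI)
    fix e :: real assume e: "0 < e"
    \<comment> \<open>The terms in \<open>L\<close> cancel in the parallelogram bound and eight
      slacks remain, hence the eighth.\<close>
    then have e8: "e\<^sup>2 / 8 > 0" by simp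
    have "\<forall>\<^sub>F n in sequentially. (norm (p n))\<^sup>2 < L\<^sup>2 + e\<^sup>2 / 8 \<and> (d n)\<^sup>2 > L\<^sup>2 - e\<^sup>2 / 8"
      using e8 by (intro eventually_conj order_tendstoD[OF pL] order_tendstoD[OF dL]) auto
    then obtain N where N: "\<And>n. n \<ge> N \<Longrightarrow> (norm (p n))\<^sup>2 < L\<^sup>2 + e\<^sup>2 / 8 \<and> (d n)\<^sup>2 > L\<^sup>2 - e\<^sup>2 / 8"
      by (auto simp: eventually_sequentially)
    have "dist (p m) (p n) < e" if "m \<ge> N" "n > m" for m n
    proof -
      have "(norm (p m - p n))\<^sup>2 < e\<^sup>2"
        using parallelogram[of m n] N[of m] N[of n] that by auto
      then show ?thesis using e by (simp add: dist_norm power_less_imp_less_base)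
    qed
    then show "\<exists>M. \<forall>m\<ge>M. \<forall>n>m. dist (p m) (p n) < e" by blast
  qed
  then obtain y where y: "p \<longlonglongrightarrow> y" using Cauchy_convergent convergentD by blast
  have "y \<in> C n" for n
  proof (rule Lim_in_closed_set[OF cl _ _ y])
    show "\<forall>\<^sub>F m in sequentially. p m \<in> C n"
      using p(1) sub by (auto simp: eventually_sequentially intro!: exI[of _ n])
  qed simp
  then show ?thesis by blast
qed

text \<open>Sublevel sets at levels falling to the infimum are closed and convex, and a common point
  attains the infimum.\<close>

lemma lower_semicontinuous_convex_attains_min:
  fixes h :: "'a::{real_inner, complete_space} \<Rightarrow> ereal"
  assumes h: "lower_semicontinuous h" "convex_fun h" and bd: "bounded {x. h x \<le> h x0}"
  shows "minimizers h \<noteq> {}"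
proof (cases "h x0 = (INF x. h x)")
  case True
  then have "x0 \<in> minimizers h" by (auto simp: minimizers_def intro: INF_lower)
  then show ?thesis by blast
next
  case False
  define m where "m = (INF x. h x)"
  have "m < h x0" using False by (simp add: m_def INF_lower less_le)
  from approx_from_above_dense_linorder[OF this]
  obtain c where c: "\<And>n. m < c n" "c \<longlonglongrightarrow> m" by blast
  \<comment> \<open>The running minimum makes the sets decrease, and \<open>h x0\<close> in it keeps
    them inside the bounded sublevel set.\<close>
  define C where "C n = {x. h x \<le> Min (insert (h x0) (c ` {..n}))}" for n :: nat
  have "(\<Inter>n. C n) \<noteq> {}"
  proof (rule nested_bounded_closed_convex_Inter_nonempty)
    show "decseq C" unfolding decseq_def C_def by fastforce
    show "C n \<noteq> {}" for n
    proof -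
      have "m < Min (insert (h x0) (c ` {..n}))" using c \<open>m < h x0\<close> by auto
      then obtain y where "h y < Min (insert (h x0) (c ` {..n}))"
        unfolding m_def INF_less_iff by blast
      then show ?thesis unfolding C_def using less_imp_le by blast
    qed
    show "bounded (C 0)" by (rule bounded_subset[OF bd]) (auto simp: C_def)
    show "closed (C n)" "convex (C n)" for n
      unfolding C_def by (rule lower_semicontinuous_closed_sublevel convex_fun_sublevel, rule h)+
  qed
  then obtain y where y: "\<And>n. y \<in> C n" by blast
  have "h y \<le> c n" for n using y[of n] by (auto simp: C_def)
  then have "h y \<le> m" using c(2) by (intro LIMSEQ_le_const) auto
  then have "y \<in> minimizers h" unfolding minimizers_def m_def by (auto intro: order_trans INF_lower)
  then show ?thesis by blast
qed

text \<open>A substitute for weak sequential compactness: \<^term>\<open>y\<close> lies in the closed convex hull of every tail.\<close>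

lemma bounded_seq_cluster:
  fixes x :: "nat \<Rightarrow> 'a::{real_inner, complete_space}"
  assumes "bounded (range x)"
  obtains y where "\<And>C. closed C \<Longrightarrow> convex C \<Longrightarrow> (\<forall>\<^sub>F n in sequentially. x n \<in> C) \<Longrightarrow> y \<in> C"
proof -
  define K where "K n = closure (convex hull (x ` {n..}))" for n
  have "(\<Inter>n. K n) \<noteq> {}"
  proof (rule nested_bounded_closed_convex_Inter_nonempty)
    show "decseq K" unfolding decseq_def K_def
      by (auto intro!: closure_mono hull_mono image_mono)
    show "bounded (K 0)" unfolding K_def
      by (intro bounded_closure bounded_convex_hull bounded_subset[OF assms]) auto
  qed (auto simp: K_def)
  then obtain y where y: "\<And>n. y \<in> K n" by blast
  have "y \<in> C" if C: "closed C" "convex C" and ev: "\<forall>\<^sub>F n in sequentially. x n \<in> C" for C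
  proof -
    obtain N where "x ` {N..} \<subseteq> C" using ev by (auto simp: eventually_sequentially)
    then have "K N \<subseteq> C" unfolding K_def using C by (intro closure_minimal hull_minimal) auto
    then show ?thesis using y by blast
  qed
  then show ?thesis using that by blast
qed

section \<open>Opial-type weak convergence\<close>

text \<open>Opial's argument, with points common to the closed convex hulls of tails in the role of
  weak subsequential limits.\<close>

lemma weakly_convergent_to_minimizer:
  fixes x :: "nat \<Rightarrow> 'a::{real_inner, complete_space}"
  assumes h: "lower_semicontinuous h" "convex_fun h"
    and lim: "(\<lambda>k. h (x k)) \<longlonglongrightarrow> s" and s: "\<And>y. s \<le> h y"
    and bd: "bounded (range x)"
    and conv: "\<And>z. z \<in> minimizers h \<Longrightarrow> convergent (\<lambda>k. norm (x k - z))"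
  shows "\<exists>xt \<in> minimizers h. weakly_convergent_to x xt"
proof -
  define cluster where "cluster r y \<longleftrightarrow> (\<forall>C. closed C \<longrightarrow> convex C \<longrightarrow>
    (\<forall>\<^sub>F n in sequentially. x (r n) \<in> C) \<longrightarrow> y \<in> C)" for r :: "nat \<Rightarrow> nat" and y
  have ex: "\<exists>y. cluster r y" for r
  proof -
    have "bounded (range (\<lambda>n. x (r n)))" by (rule bounded_subset[OF bd]) auto
    from bounded_seq_cluster[OF this] show ?thesis unfolding cluster_def by metis
  qed
  \<comment> \<open>Half-spaces are closed and convex, so eventual linear bounds pass to cluster
    points.\<close>
  have le: "y \<bullet> v \<le> b" if "cluster r y" "\<forall>\<^sub>F n in sequentially. x (r n) \<bullet> v \<le> b" for r y v b
    using that closed_halfspace_le[of v b] convex_halfspace_le[of v b]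
    unfolding cluster_def by (auto simp: inner_commute)
  have min: "y \<in> minimizers h" if "cluster r y" "strict_mono r" for r y
  proof -
    have "h y \<le> s"
    proof (rule dense_ge)
      fix c assume "s < c"
      have "(\<lambda>n. h (x (r n))) \<longlonglongrightarrow> s"
        using LIMSEQ_subseq_LIMSEQ[OF lim that(2)] by (simp add: o_def)
      then have "\<forall>\<^sub>F n in sequentially. h (x (r n)) < c"
        using \<open>s < c\<close> by (rule order_tendstoD)
      then have "\<forall>\<^sub>F n in sequentially. x (r n) \<in> {y. h y \<le> c}"
        by eventually_elim simp
      then show "h y \<le> c"
        using that(1) lower_semicontinuous_closed_sublevel[OF h(1), of c]
          convex_fun_sublevel[OF h(2), of c] unfolding cluster_def by blast
    qed
    then show ?thesis using s unfolding minimizers_def by (auto intro: order_trans)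
  qed
  have lim_le: "y \<bullet> v \<le> l" if "cluster r y" "(\<lambda>n. x (r n) \<bullet> v) \<longlonglongrightarrow> l" for r y v l
  proof (rule field_le_epsilon)
    fix e :: real assume "0 < e"
    then have "\<forall>\<^sub>F n in sequentially. x (r n) \<bullet> v < l + e"
      using that(2) by (intro order_tendstoD) auto
    then show "y \<bullet> v \<le> l + e" by (intro le[OF that(1)]) (auto elim: eventually_mono)
  qed
  \<comment> \<open>The upper bound, applied to \<open>v\<close> and to \<open>- v\<close>, gives
    equality.\<close>
  have lim_eq: "y \<bullet> v = l" if "cluster r y" "(\<lambda>n. x (r n) \<bullet> v) \<longlonglongrightarrow> l" for r y v l
    using lim_le[OF that] lim_le[OF that(1), of "- v" "- l"] tendsto_minus[OF that(2)] by auto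
  have unique: "y = y'"
    if y: "cluster r y" "strict_mono r" and y': "cluster r' y'" "strict_mono r'" for r r' y y'
  proof -
    obtain a b where ab: "(\<lambda>k. norm (x k - y)) \<longlonglongrightarrow> a" "(\<lambda>k. norm (x k - y')) \<longlonglongrightarrow> b"
      using conv min y y' by (meson convergentD)
    \<comment> \<open>Expanding the squares expresses \<open>x k \<bullet> (y - y')\<close> through
      the two distances, whose limits exist since \<open>y\<close> and \<open>y'\<close> are
      minimizers. Convergence is along the whole sequence, so \<open>r\<close> and \<open>r'\<close>
      share the limit \<open>l\<close>.\<close>
    define l where "l = ((norm y)\<^sup>2 - (norm y')\<^sup>2 - (a\<^sup>2 - b\<^sup>2)) / 2"
    have *: "(\<lambda>k. x k \<bullet> (y - y')) =
        (\<lambda>k. ((norm y)\<^sup>2 - (norm y')\<^sup>2 - ((norm (x k - y))\<^sup>2 - (norm (x k - y'))\<^sup>2)) / 2)"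
      by (rule ext) (simp add: power2_norm_eq_inner algebra_simps inner_commute)
    have l: "(\<lambda>k. x k \<bullet> (y - y')) \<longlonglongrightarrow> l"
      unfolding l_def * using ab by (auto intro!: tendsto_intros)
    have "y \<bullet> (y - y') = l" "y' \<bullet> (y - y') = l"
      using lim_eq[OF y(1) LIMSEQ_subseq_LIMSEQ[OF l y(2), unfolded o_def]]
        lim_eq[OF y'(1) LIMSEQ_subseq_LIMSEQ[OF l y'(2), unfolded o_def]] by blast+
    then have "(y - y') \<bullet> (y - y') = 0" by (simp add: inner_diff_left)
    then show ?thesis by simp
  qed
  obtain y where y: "cluster id y" using ex by blast
  \<comment> \<open>Otherwise some subsequence violates the bound throughout, and its cluster point,
    which must be \<open>y\<close>, inherits the violation.\<close>
  have upper: "\<forall>\<^sub>F k in sequentially. x k \<bullet> v < y \<bullet> v + e" if "0 < e" for v and e :: real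
  proof (rule ccontr)
    assume "\<not> ?thesis"
    then have "infinite {k. y \<bullet> v + e \<le> x k \<bullet> v}"
      by (simp add: eventually_cofinite not_less flip: cofinite_eq_sequentially)
    from infinite_enumerate[OF this]
    obtain r :: "nat \<Rightarrow> nat" where r: "strict_mono r" "\<And>n. y \<bullet> v + e \<le> x (r n) \<bullet> v" by auto
    obtain y' where y': "cluster r y'" using ex by blast
    have "y' \<bullet> (- v) \<le> - (y \<bullet> v + e)"
      by (rule le[OF y'], rule always_eventually) (use r(2) in \<open>simp add: algebra_simps\<close>)
    then show False using unique[OF y _ y' r(1)] that by (simp add: strict_mono_def)
  qed
  have "(\<lambda>k. x k \<bullet> v) \<longlonglongrightarrow> y \<bullet> v" for v
  proof (rule tendstoI)
    fix e :: real assume "0 < e"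
    show "\<forall>\<^sub>F k in sequentially. dist (x k \<bullet> v) (y \<bullet> v) < e"
      using upper[OF \<open>0 < e\<close>, of v] upper[OF \<open>0 < e\<close>, of "- v"]
      by eventually_elim (auto simp: dist_real_def)
  qed
  moreover have "y \<in> minimizers h" using min[OF y] by (simp add: strict_mono_def)
  ultimately show ?thesis unfolding weakly_convergent_to_def by blast
qed

section \<open>Proximal points\<close>

definition prox_objective :: "real \<Rightarrow> ('a::real_inner \<Rightarrow> ereal) \<Rightarrow> 'a \<Rightarrow> 'a \<Rightarrow> ereal" where
  "prox_objective \<alpha> h z y = ereal \<alpha> * h y + ereal ((norm (y - z))\<^sup>2 / 2)"

text \<open>This says that \<open>(z - p) / \<alpha>\<close> is a subgradient at \<open>p\<close>,
  tested at points of finite value. It comes from comparing \<open>p\<close> with points of the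
  segment to \<open>y\<close>.\<close>

lemma prox_objective_minimizer_variational:
  assumes h: "convex_fun h" and \<alpha>: "0 < \<alpha>" and p: "p \<in> minimizers (prox_objective \<alpha> h z)"
    and a: "h p = ereal a" and b: "h y = ereal b"
  shows "\<alpha> * a + (z - p) \<bullet> (y - p) \<le> \<alpha> * b"
proof -
  \<comment> \<open>\<open>e\<close> is the amount by which the claim could fail; the comparison
    bounds it by \<open>t * q\<close>, and \<open>t\<close> tends to 0.\<close>
  define e where "e = \<alpha> * a + (z - p) \<bullet> (y - p) - \<alpha> * b"
  define q where "q = (norm (y - p))\<^sup>2 / 2"
  have *: "e \<le> t * q" if t: "0 < t" "t < 1" for t
  proof -
    define m where "m = (1 - t) *\<^sub>R p + t *\<^sub>R y"
    have "h m \<le> ereal ((1 - t) * a + t * b)"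
      using h t a b unfolding convex_fun_def m_def by (metis times_ereal.simps(1) plus_ereal.simps(1))
    then have "prox_objective \<alpha> h z m \<le> ereal (\<alpha> * ((1 - t) * a + t * b) + (norm (m - z))\<^sup>2 / 2)"
      unfolding prox_objective_def using \<alpha>
      by (metis add_right_mono ereal_mult_left_mono ereal_less_eq(5) less_imp_le
          times_ereal.simps(1) plus_ereal.simps(1))
    moreover have "prox_objective \<alpha> h z p \<le> prox_objective \<alpha> h z m"
      using p by (auto simp: minimizers_def)
    ultimately have "\<alpha> * a + (norm (p - z))\<^sup>2 / 2 \<le> \<alpha> * ((1 - t) * a + t * b) + (norm (m - z))\<^sup>2 / 2"
      using a order_trans by (fastforce simp: prox_objective_def)
    moreover have "(norm (m - z))\<^sup>2 = (norm (p - z))\<^sup>2 - t * (2 * ((z - p) \<bullet> (y - p))) + t * (t * (2 * q))"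
      unfolding m_def q_def by (simp add: power2_norm_eq_inner field_simps inner_simps inner_commute)
    moreover have "t * e = t * ((z - p) \<bullet> (y - p)) + \<alpha> * a - \<alpha> * ((1 - t) * a + t * b)"
      unfolding e_def by (simp add: algebra_simps)
    ultimately have "t * e \<le> t * (t * q)" by linarith
    then show ?thesis using t by simp
  qed
  have "((\<lambda>t. t * q) \<longlongrightarrow> 0 * q) (at_right 0)" by (intro tendsto_intros)
  moreover have "\<forall>\<^sub>F t in at_right 0. e \<le> t * q"
    unfolding eventually_at_right_field using * by (intro exI[of _ 1]) auto
  ultimately have "e \<le> 0 * q" by (intro tendsto_lowerbound) auto
  then show ?thesis by (simp add: e_def)
qed

text \<open>Tested at a point of the domain, the subgradient inequality excludes the value
  \<infinity> at \<open>y\<close>.\<close>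

lemma subdifferential_imp_finite:
  assumes "proper h" "v \<in> subdifferential h y"
  obtains a where "h y = ereal a"
proof -
  obtain x0 where "h x0 < \<infinity>" using assms(1) by (auto simp: proper_def effective_domain_def)
  moreover have "h y + ereal (v \<bullet> (x0 - y)) \<le> h x0" using assms(2) by (auto simp: subdifferential_def)
  ultimately have "h y \<noteq> \<infinity>" by auto
  moreover have "h y \<noteq> -\<infinity>" using assms(1) by (auto simp: proper_def)
  ultimately show ?thesis using that by (cases "h y") auto
qed

text \<open>A subgradient at \<open>x0\<close> provides an affine minorant of \<open>h\<close>,
  whose decrease the quadratic term outgrows.\<close>

lemma prox_objective_sublevel_bounded:
  assumes "proper h" and v: "v \<in> subdifferential h x0" and \<alpha>: "0 < \<alpha>"
  shows "bounded {y. prox_objective \<alpha> h z y \<le> prox_objective \<alpha> h z x0}"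
proof -
  obtain a where a: "h x0 = ereal a" using subdifferential_imp_finite assms(1,2) .
  define A where "A = \<alpha> * norm v"
  \<comment> \<open>\<open>M\<close> is what remains on the right after completing the square in
    \<open>norm (y - z)\<close>.\<close>
  define M where "M = (norm (x0 - z))\<^sup>2 - 2 * \<alpha> * (v \<bullet> (z - x0)) + A\<^sup>2"
  have "norm (y - z) \<le> A + sqrt M"
    if y: "prox_objective \<alpha> h z y \<le> prox_objective \<alpha> h z x0" for y
  proof -
    have "h y \<noteq> \<infinity>" using y a \<alpha> by (auto simp: prox_objective_def)
    moreover have "h y \<noteq> -\<infinity>" using assms(1) by (auto simp: proper_def)
    ultimately obtain b where b: "h y = ereal b" by (cases "h y") auto
    have "h x0 + ereal (v \<bullet> (y - x0)) \<le> h y" using v by (auto simp: subdifferential_def)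
    then have "a + v \<bullet> (y - x0) \<le> b" by (simp add: a b)
    then have "\<alpha> * (a + v \<bullet> (y - x0)) \<le> \<alpha> * b" using \<alpha> by simp
    moreover have "\<alpha> * b + (norm (y - z))\<^sup>2 / 2 \<le> \<alpha> * a + (norm (x0 - z))\<^sup>2 / 2"
      using y by (simp add: prox_objective_def a b)
    moreover have "- (A * norm (y - z)) \<le> \<alpha> * (v \<bullet> (y - z))"
      using mult_left_mono[of "- (norm v * norm (y - z))" "v \<bullet> (y - z)" \<alpha>]
        Cauchy_Schwarz_ineq2[of v "y - z"] \<alpha> by (simp add: A_def mult.assoc abs_le_iff)
    ultimately have "(norm (y - z) - A)\<^sup>2 \<le> M"
      unfolding M_def by (simp add: power2_diff algebra_simps inner_diff_right)
    then have "norm (y - z) - A \<le> sqrt M" by (rule real_le_rsqrt)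
    then show ?thesis by simp
  qed
  then show ?thesis unfolding bounded_any_center[where a = z] by (auto simp: dist_norm norm_minus_commute)
qed

text \<open>\<open>prox\<close> is a definite description, so existence and uniqueness must be known
  before it can be used. The subgradient \<open>v\<close> serves existence, through bounded sublevel
  sets; uniqueness follows by adding the variational inequalities of two minimizers.\<close>

lemma prox_in_minimizers:
  fixes h :: "'a::{real_inner, complete_space} \<Rightarrow> ereal"
  assumes h: "proper h" "lower_semicontinuous h" "convex_fun h"
    and v: "v \<in> subdifferential h x0" and \<alpha>: "0 < \<alpha>"
  shows "prox \<alpha> h z \<in> minimizers (prox_objective \<alpha> h z)"
    and "\<exists>a. h (prox \<alpha> h z) = ereal a"
proof -
  have nminf: "h y \<noteq> -\<infinity>" for y using h(1) by (auto simp: proper_def)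
  have obj: "prox_objective \<alpha> h z = (\<lambda>y. ereal \<alpha> * h y + ereal ((norm (y - z))\<^sup>2 / 2))"
    by (auto simp: prox_objective_def)
  have "lower_semicontinuous (prox_objective \<alpha> h z)"
    unfolding obj using h(2) \<alpha> nminf
    by (intro lower_semicontinuous_add lower_semicontinuous_cmult lower_semicontinuous_real
        continuous_intros) auto
  moreover have "convex_fun (prox_objective \<alpha> h z)"
    unfolding obj using h(3) \<alpha> by (intro convex_fun_add convex_fun_cmult convex_fun_norm_sq) auto
  ultimately obtain p where p: "p \<in> minimizers (prox_objective \<alpha> h z)"
    using lower_semicontinuous_convex_attains_min prox_objective_sublevel_bounded[OF h(1) v \<alpha>]
    by blast
  have fin: "\<exists>a. h q = ereal a" if "q \<in> minimizers (prox_objective \<alpha> h z)" for q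
  proof -
    obtain a where "h x0 = ereal a" using subdifferential_imp_finite h(1) v .
    moreover have "prox_objective \<alpha> h z q \<le> prox_objective \<alpha> h z x0"
      using that by (auto simp: minimizers_def)
    ultimately have "h q \<noteq> \<infinity>" using \<alpha> by (auto simp: prox_objective_def)
    then show ?thesis using nminf[of q] by (cases "h q") auto
  qed
  have unique: "q = p" if q: "q \<in> minimizers (prox_objective \<alpha> h z)" for q
  proof -
    obtain a b where ab: "h p = ereal a" "h q = ereal b" using fin p q by blast
    have "(z - p) \<bullet> (q - p) + (z - q) \<bullet> (p - q) \<le> 0"
      using prox_objective_minimizer_variational[OF h(3) \<alpha> p ab]
        prox_objective_minimizer_variational[OF h(3) \<alpha> q ab(2,1)] by linarith
    then have "(q - p) \<bullet> (q - p) \<le> 0" by (simp add: algebra_simps inner_commute)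
    then show ?thesis by (simp add: power2_norm_eq_inner[symmetric])
  qed
  have eq: "prox \<alpha> h z = p" unfolding prox_def obj[symmetric]
    using p unique by (rule the_equality)
  then show "prox \<alpha> h z \<in> minimizers (prox_objective \<alpha> h z)" "\<exists>a. h (prox \<alpha> h z) = ereal a"
    unfolding eq using p fin[OF p] by blast+
qed

text \<open>Three inequalities are added: optimality of \<open>p\<close> tested at \<open>z\<close>,
  the subgradient inequality of \<open>f\<close> from \<open>y\<close> to \<open>z\<close>, and that
  of \<open>g\<close> from \<open>y\<close> to \<open>p\<close>. The last one replaces
  \<open>g p\<close> by the value at the old point \<open>y\<close>.\<close>

lemma prox_subgradient_step:
  fixes f g :: "'a::{real_inner, complete_space} \<Rightarrow> ereal"
  assumes g: "proper g" "lower_semicontinuous g" "convex_fun g"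
    and u: "u \<in> subdifferential f y" and w: "w \<in> subdifferential g y" and \<alpha>: "0 < \<alpha>"
    and p: "p = prox \<alpha> g (y - \<alpha> *\<^sub>R u)"
    and val: "f y = ereal fy" "g y = ereal gy" "f z = ereal fz" "g z = ereal gz"
  shows "(norm (p - z))\<^sup>2 \<le>
    (norm (y - z))\<^sup>2 - 2 * \<alpha> * ((fy + gy) - (fz + gz)) + \<alpha>\<^sup>2 * (norm u + norm w)\<^sup>2"
proof -
  obtain gp where gp: "g p = ereal gp" using prox_in_minimizers(2)[OF g w \<alpha>] p by blast
  have prox: "\<alpha> * gp + (y - \<alpha> *\<^sub>R u - p) \<bullet> (z - p) \<le> \<alpha> * gz"
    using prox_objective_minimizer_variational[OF g(3) \<alpha> _ gp val(4)]
      prox_in_minimizers(1)[OF g w \<alpha>] p by blast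
  have "f y + ereal (u \<bullet> (z - y)) \<le> f z" using u by (auto simp: subdifferential_def)
  then have "\<alpha> * (fy + u \<bullet> (z - y)) \<le> \<alpha> * fz" using \<alpha> by (simp add: val)
  moreover have "g y + ereal (w \<bullet> (p - y)) \<le> g p" using w by (auto simp: subdifferential_def)
  then have "\<alpha> * (gy + w \<bullet> (p - y)) \<le> \<alpha> * gp" using \<alpha> by (simp add: val gp)
  \<comment> \<open>Completing the square: the leftover terms in \<open>y - p\<close> fall short of
    \<open>\<alpha>\<^sup>2 * (norm (u + w))\<^sup>2\<close> by exactly this square.\<close>
  moreover have "0 \<le> (norm (y - p - \<alpha> *\<^sub>R (u + w)))\<^sup>2" by simp
  moreover have "(norm (u + w))\<^sup>2 \<le> (norm u + norm w)\<^sup>2"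
    by (intro power_mono norm_triangle_ineq) simp
  then have "\<alpha>\<^sup>2 * (norm (u + w))\<^sup>2 \<le> \<alpha>\<^sup>2 * (norm u + norm w)\<^sup>2" by (rule mult_left_mono) simp
  ultimately show ?thesis
    using prox by (simp add: power2_norm_eq_inner algebra_simps inner_commute power2_eq_square[of \<alpha>])
qed

section \<open>Closedness of the domain and the liminf rate\<close>

text \<open>Bounded subgradients along a convergent sequence, tested at a fixed \<open>x0\<close>,
  bound the values of \<open>g\<close> there, and a closed sublevel set keeps the limit. This makes
  A1, which speaks of closed subsets of the domain, applicable to the closure of the
  iterates.\<close>

lemma closed_effective_domain:
  assumes g: "lower_semicontinuous g" "proper g"
    and \<rho>: "\<forall>y\<in>effective_domain g. subdifferential g y \<inter> cball 0 \<rho> \<noteq> {}"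
  shows "closed (effective_domain g)"
  unfolding closed_sequential_limits
proof (intro allI impI, elim conjE)
  fix y l assume y: "\<forall>n. y n \<in> effective_domain g" and l: "y \<longlonglongrightarrow> l"
  obtain x0 where x0: "g x0 < \<infinity>" using g(2) by (auto simp: proper_def effective_domain_def)
  then obtain a where a: "g x0 = ereal a" using g(2) by (cases "g x0") (auto simp: proper_def)
  obtain B where B: "\<And>n. norm (y n - x0) \<le> B"
    using convergent_imp_Bseq[OF convergentI[OF tendsto_diff[OF l tendsto_const[of x0]]]]
    by (auto simp: Bseq_def)
  have "g (y n) \<le> ereal (a + \<rho> * B)" for n
  proof -
    obtain v where v: "v \<in> subdifferential g (y n)" "norm v \<le> \<rho>" using \<rho> y by fastforce
    have ineq: "g (y n) + ereal (v \<bullet> (x0 - y n)) \<le> g x0" using v by (auto simp: subdifferential_def)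
    obtain b where b: "g (y n) = ereal b" using subdifferential_imp_finite[OF g(2) v(1)] .
    have "\<bar>v \<bullet> (x0 - y n)\<bar> \<le> norm v * norm (y n - x0)"
      using Cauchy_Schwarz_ineq2[of v "x0 - y n"] by (simp add: norm_minus_commute)
    also have "\<dots> \<le> \<rho> * B" using v(2) B[of n] by (intro mult_mono) (auto intro: order_trans[OF norm_ge_zero])
    finally show ?thesis using ineq by (simp add: a b)
  qed
  then have "l \<in> {x. g x \<le> ereal (a + \<rho> * B)}"
    using l lower_semicontinuous_closed_sublevel[OF g(1)]
    by (intro closed_sequentially[of "{x. g x \<le> ereal (a + \<rho> * B)}" y l]) auto
  then show "l \<in> effective_domain g" by (auto simp: effective_domain_def intro: le_less_trans)
qed

text \<open>A positive liminf would make the squares eventually dominate a multiple of the harmonic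
  series.\<close>

lemma liminf_sqrt_mult_eq_0:
  fixes e :: "nat \<Rightarrow> real"
  assumes pos: "\<And>k. 0 \<le> e k" and sum: "summable (\<lambda>k. (e k)\<^sup>2)"
  shows "liminf (\<lambda>k. ereal (sqrt (real (k + 1)) * e k)) = 0"
proof (rule antisym)
  show "0 \<le> liminf (\<lambda>k. ereal (sqrt (real (k + 1)) * e k))"
    using pos by (intro Liminf_bounded) auto
  show "liminf (\<lambda>k. ereal (sqrt (real (k + 1)) * e k)) \<le> 0"
  proof (rule ccontr)
    assume "\<not> ?thesis"
    then have "0 < liminf (\<lambda>k. ereal (sqrt (real (k + 1)) * e k))" by simp
    then obtain c where c: "0 < ereal c" "ereal c < liminf (\<lambda>k. ereal (sqrt (real (k + 1)) * e k))"
      using ereal_dense2 by blast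
    have "\<forall>\<^sub>F k in sequentially. norm (c\<^sup>2 * inverse (of_nat (Suc k))) \<le> (e k)\<^sup>2"
      using less_LiminfD[OF c(2)]
    proof eventually_elim
      case (elim k)
      then have "c\<^sup>2 \<le> (sqrt (real (k + 1)) * e k)\<^sup>2" using c by (intro power_mono) auto
      also have "\<dots> = real (Suc k) * (e k)\<^sup>2" by (simp add: power_mult_distrib)
      finally show ?case by (simp add: field_simps)
    qed
    then have "summable (\<lambda>k. c\<^sup>2 * inverse (of_nat (Suc k) :: real))"
      by (rule summable_comparison_test_ev[OF _ sum])
    then have "summable (\<lambda>k. inverse (of_nat (Suc k) :: real))"
      using c by (subst (asm) summable_cmult_iff) auto
    then show False using not_summable_harmonic[where 'a = real] by (subst (asm) summable_Suc_iff) blast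
  qed
qed

section \<open>Convergence with the Polyak stepsize\<close>

text \<open>A2 bounds only some subgradient of \<open>g\<close> at each point, while
  \<open>w k\<close> is chosen freely. Hence the claims after the Fejer property carry the premise
  that \<open>w\<close> is bounded, which together with A1 bounds the denominators of the
  stepsizes.\<close>

theorem corollary2p11:
  fixes f g :: "'a::{real_inner, complete_space} \<Rightarrow> ereal"
    and x u w :: "nat \<Rightarrow> 'a"
    and \<alpha> \<gamma>' :: "nat \<Rightarrow> real"
    and \<gamma> :: real
    and s :: ereal
  assumes nontrivial: "\<exists>v::'a. v \<noteq> 0"
    and f: "proper f" "lower_semicontinuous f" "convex_fun f"
    and g: "proper g" "lower_semicontinuous g" "convex_fun g"
    and dom: "effective_domain g \<subseteq> effective_domain f"
    and A1: "\<forall>V. bounded V \<and> closed V \<and> V \<subseteq> effective_domain g \<longrightarrow>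
               (\<exists>\<zeta>>0. \<forall>y\<in>V. subdifferential f y \<subseteq> cball 0 \<zeta>)"
    and A2: "\<exists>\<rho>\<ge>0. \<forall>y\<in>effective_domain g. subdifferential g y \<inter> cball 0 \<rho> \<noteq> {}"
    and S_nonempty: "minimizers (\<lambda>y. f y + g y) \<noteq> {}"
    and s: "s = (INF y. f y + g y)"
    and pss: "pss_sequence f g \<alpha> u x"
    and w: "\<forall>k. w k \<in> subdifferential g (x k)"
    and \<gamma>: "0 < \<gamma>" "\<forall>k. \<gamma> \<le> \<gamma>' k \<and> \<gamma>' k \<le> 2 - \<gamma>"
    and stepsize: "\<forall>k. ereal (\<alpha> k) = ereal (\<gamma>' k) * ((f (x k) + g (x k)) - s)
               / ereal ((norm (u k))\<^sup>2 + 2 * norm (w k) * norm (u k) + (norm (w k))\<^sup>2)"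
  shows "fejer_convergent x (minimizers (\<lambda>y. f y + g y)) \<and>
    (bounded (range w) \<longrightarrow>
       (\<lambda>k. f (x k) + g (x k)) \<longlonglongrightarrow> s \<and>
       (\<exists>xt \<in> minimizers (\<lambda>y. f y + g y). weakly_convergent_to x xt) \<and>
       liminf (\<lambda>k. ereal (sqrt (real (k + 1))) * ((f (x k) + g (x k)) - s)) = 0)"
proof -
  define S where "S = minimizers (\<lambda>y. f y + g y)"
  have \<alpha>: "0 < \<alpha> k" and u: "u k \<in> subdifferential f (x k)"
    and xSuc: "x (Suc k) = prox (\<alpha> k) g (x k - \<alpha> k *\<^sub>R u k)" for k
    using pss by (auto simp: pss_sequence_def)
  \<comment> \<open>Finite values at the iterates come from the given subgradients rather than from
    an induction along the proximal steps.\<close>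
  have "\<exists>a. f (x k) = ereal a" "\<exists>a. g (x k) = ereal a" for k
    using subdifferential_imp_finite f(1) g(1) u w by metis+
  then obtain fx gx where fx: "\<And>k. f (x k) = ereal (fx k)" and gx: "\<And>k. g (x k) = ereal (gx k)"
    by metis
  have s_le: "s \<le> f y + g y" for y unfolding s by (rule INF_lower) simp
  have S_val: "f z + g z = s" if "z \<in> S" for z
    using that s_le[of z] unfolding S_def minimizers_def s by (auto intro: antisym INF_greatest)
  have S_fin: "\<exists>a b. f z = ereal a \<and> g z = ereal b" if "z \<in> S" for z
  proof -
    have "f z + g z \<le> f (x 0) + g (x 0)" using that by (auto simp: S_def minimizers_def)
    then have "f z \<noteq> \<infinity>" "g z \<noteq> \<infinity>" by (auto simp: fx gx)
    moreover have "f z \<noteq> -\<infinity>" "g z \<noteq> -\<infinity>" using f g by (auto simp: proper_def)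
    ultimately show ?thesis by (cases "f z"; cases "g z") auto
  qed
  obtain z0 where z0: "z0 \<in> S" using S_nonempty S_def by blast
  obtain s0 where s0: "s = ereal s0" using S_val[OF z0] S_fin[OF z0] by force
  define e where "e k = fx k + gx k - s0" for k
  \<comment> \<open>The stepsize denominator is this perfect square.\<close>
  define D where "D k = (norm (u k) + norm (w k))\<^sup>2" for k
  have gap: "f (x k) + g (x k) - s = ereal (e k)" for k by (simp add: fx gx s0 e_def)
  have e_nonneg: "0 \<le> e k" for k using s_le[of "x k"] by (simp add: e_def fx gx s0)
  have step_D: "ereal (\<alpha> k) = ereal (\<gamma>' k * e k) / ereal (D k)" for k
    using stepsize[rule_format, of k] unfolding gap D_def by (simp add: power2_sum algebra_simps)
  \<comment> \<open>A vanishing denominator would give a stepsize of 0 or an infinite one, as x / 0 = x * \<infinity> in ereal.\<close>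
  have D_pos: "0 < D k" for k
  proof -
    have "D k \<noteq> 0" using step_D[of k] \<alpha>[of k] by (auto simp: divide_ereal_def split: if_splits)
    then show ?thesis by (simp add: D_def)
  qed
  have \<alpha>_eq: "\<alpha> k = \<gamma>' k * e k / D k" for k using step_D[of k] D_pos[of k] by simp
  have descent: "(norm (x (Suc k) - z))\<^sup>2 \<le> (norm (x k - z))\<^sup>2 - \<gamma>\<^sup>2 * ((e k)\<^sup>2 / D k)"
    if "z \<in> S" for z k
  proof -
    obtain a b where ab: "f z = ereal a" "g z = ereal b" using S_fin \<open>z \<in> S\<close> by blast
    then have "a + b = s0" using S_val[OF \<open>z \<in> S\<close>] s0 by simp
    then have "(norm (x (Suc k) - z))\<^sup>2 \<le> (norm (x k - z))\<^sup>2 - 2 * \<alpha> k * e k + (\<alpha> k)\<^sup>2 * D k"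
      using prox_subgradient_step[OF g u w[rule_format] \<alpha> xSuc fx gx ab] by (simp add: e_def D_def)
    \<comment> \<open>Inserting the stepsize merges the linear and the quadratic term.\<close>
    also have "\<dots> = (norm (x k - z))\<^sup>2 - \<gamma>' k * (2 - \<gamma>' k) * ((e k)\<^sup>2 / D k)"
      unfolding \<alpha>_eq using D_pos[of k] by (simp add: field_simps power2_eq_square)
    also have "\<dots> \<le> (norm (x k - z))\<^sup>2 - \<gamma>\<^sup>2 * ((e k)\<^sup>2 / D k)"
    proof -
      \<comment> \<open>Both \<open>\<gamma>' k\<close> and \<open>2 - \<gamma>' k\<close> are at
        least \<open>\<gamma>\<close>.\<close>
      have "\<gamma> * \<gamma> \<le> \<gamma>' k * (2 - \<gamma>' k)"
        using \<gamma>(1) \<gamma>(2)[rule_format, of k] by (intro mult_mono) auto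
      then show ?thesis
        using D_pos[of k] by (intro diff_left_mono mult_right_mono) (auto simp: power2_eq_square)
    qed
    finally show ?thesis .
  qed
  have decr: "norm (x (Suc k) - z) \<le> norm (x k - z)" if "z \<in> S" for z k
  proof (rule power2_le_imp_le)
    show "(norm (x (Suc k) - z))\<^sup>2 \<le> (norm (x k - z))\<^sup>2"
      using descent[OF that, of k] D_pos[of k] by (smt (verit) divide_nonneg_pos mult_nonneg_nonneg zero_le_power2)
  qed simp
  have conv: "convergent (\<lambda>k. norm (x k - z))" if "z \<in> S" for z
  proof -
    have "decseq (\<lambda>k. norm (x k - z))" using decr[OF that] by (rule decseq_SucI)
    then obtain L where "(\<lambda>k. norm (x k - z)) \<longlonglongrightarrow> L"
      by (rule decseq_convergent[of _ 0]) simp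
    then show ?thesis by (rule convergentI)
  qed
  have "fejer_convergent x S"
    unfolding fejer_convergent_def
  proof (intro conjI ballI allI)
    show "S \<noteq> {}" using z0 by blast
  qed (rule decr)
  moreover have "(\<lambda>k. f (x k) + g (x k)) \<longlonglongrightarrow> s \<and> (\<exists>xt \<in> S. weakly_convergent_to x xt) \<and>
       liminf (\<lambda>k. ereal (sqrt (real (k + 1))) * ((f (x k) + g (x k)) - s)) = 0"
    if bw: "bounded (range w)"
  proof -
    have "norm (x k - z0) \<le> norm (x 0 - z0)" for k
      using decr[OF z0] by (rule decseqD[OF decseq_SucI]) simp
    then have bx: "bounded (range x)"
      unfolding bounded_any_center[where a = z0] by (auto simp: dist_norm norm_minus_commute)
    have "closed (effective_domain g)" using A2 closed_effective_domain[OF g(2,1)] by blast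
    \<comment> \<open>The closure of the orbit stays in the domain, so A1 yields one bound for all
      \<open>u k\<close>.\<close>
    then have "closure (range x) \<subseteq> effective_domain g"
      by (intro closure_minimal) (auto simp: effective_domain_def gx)
    then obtain \<zeta> where \<zeta>: "\<zeta> > 0" "\<forall>y\<in>closure (range x). subdifferential f y \<subseteq> cball 0 \<zeta>"
      using A1[rule_format, of "closure (range x)"] bx by (auto intro: bounded_closure)
    have u_bd: "norm (u k) \<le> \<zeta>" for k
      using \<zeta>(2) u[of k] closure_subset[of "range x"] by (force simp: subset_iff)
    obtain W where W: "\<And>k. norm (w k) \<le> W" using bw by (auto simp: bounded_iff)
    define M where "M = (\<zeta> + W)\<^sup>2"
    have D_le: "D k \<le> M" for k
      unfolding D_def M_def by (intro power_mono add_mono u_bd W) auto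
    have M_pos: "0 < M" using D_pos D_le by (rule less_le_trans)
    \<comment> \<open>Each squared gap is at most a constant times the drop of the squared distance
      to \<open>z0\<close>, and these drops telescope.\<close>
    have "summable (\<lambda>k. (e k)\<^sup>2)"
    proof (rule summable_comparison_test')
      obtain L where "(\<lambda>k. norm (x k - z0)) \<longlonglongrightarrow> L" using conv[OF z0] convergentD by blast
      then have "(\<lambda>k. (norm (x k - z0))\<^sup>2) \<longlonglongrightarrow> L\<^sup>2" by (intro tendsto_intros)
      then show "summable (\<lambda>k. M / \<gamma>\<^sup>2 * ((norm (x k - z0))\<^sup>2 - (norm (x (Suc k) - z0))\<^sup>2))"
        by (intro summable_mult telescope_summable')
      show "norm ((e k)\<^sup>2) \<le> M / \<gamma>\<^sup>2 * ((norm (x k - z0))\<^sup>2 - (norm (x (Suc k) - z0))\<^sup>2)" for k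
      proof -
        have "\<gamma>\<^sup>2 * ((e k)\<^sup>2 / M) \<le> \<gamma>\<^sup>2 * ((e k)\<^sup>2 / D k)"
          using D_pos[of k] D_le[of k] by (intro mult_left_mono divide_left_mono) auto
        also have "\<dots> \<le> (norm (x k - z0))\<^sup>2 - (norm (x (Suc k) - z0))\<^sup>2"
          using descent[OF z0, of k] by simp
        finally have "M / \<gamma>\<^sup>2 * (\<gamma>\<^sup>2 * ((e k)\<^sup>2 / M)) \<le>
            M / \<gamma>\<^sup>2 * ((norm (x k - z0))\<^sup>2 - (norm (x (Suc k) - z0))\<^sup>2)"
          using M_pos by (intro mult_left_mono) auto
        then show ?thesis using M_pos \<gamma>(1) by simp
      qed
    qed
    note sum = this
    have "(\<lambda>k. sqrt ((e k)\<^sup>2)) \<longlonglongrightarrow> sqrt 0"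
      by (intro tendsto_real_sqrt summable_LIMSEQ_zero sum)
    then have "e \<longlonglongrightarrow> 0" using e_nonneg by simp
    then have "(\<lambda>k. ereal (e k + s0)) \<longlonglongrightarrow> ereal (0 + s0)" by (intro tendsto_intros)
    then have lim: "(\<lambda>k. f (x k) + g (x k)) \<longlonglongrightarrow> s" by (simp add: fx gx e_def s0)
    have "lower_semicontinuous (\<lambda>y. f y + g y)"
      using f g by (intro lower_semicontinuous_add) (auto simp: proper_def)
    moreover have "convex_fun (\<lambda>y. f y + g y)" using f g by (intro convex_fun_add)
    ultimately have "\<exists>xt \<in> S. weakly_convergent_to x xt"
      unfolding S_def using lim s_le bx conv unfolding S_def
      by (rule weakly_convergent_to_minimizer)
    moreover have "liminf (\<lambda>k. ereal (sqrt (real (k + 1))) * ((f (x k) + g (x k)) - s)) = 0"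
      unfolding gap using liminf_sqrt_mult_eq_0[of e] e_nonneg sum by simp
    ultimately show ?thesis using lim by blast
  qed
  ultimately show ?thesis unfolding S_def by blast
qed

end
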